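(* Let $R$ be a commutative topological ring and consider the map $f:R^{\ast}\rightarrow R\times R$ given by $a\mapsto(a,a^{-1})$, where $R\times R$ has the product topology. Then $R^{\ast}$ with the topology induced by $f$ is a topological group.
   Context: Rings are commutative with identity. A topological ring is a ring with a topology for which the ring operations are continuous. $R^{\ast}$ is the group of units of $R$. If $S$ is a set, $(X,\mathscr{T})$ a topological space and $f:S\rightarrow X$ a map, the topology on $S$ induced by $f$ is $\mathscr{T}_{f}=\{f^{-1}(U):U\in\mathscr{T}\}$. No separation axiom is assumed. *)

theory Defs
  imports "HOL-Analysis.Product_Topology" "HOL-Algebra.Ring"
begin

(* No separation axiom is imposed, and the zero ring is not excluded. *)

locale topological_group = group G for G (structure) +
  fixes T :: "'a topology"
  assumes topspace_eq_carrier: "topspace T = carrier G"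
    and continuous_mult: "continuous_map (prod_topology T T) T (\<lambda>(x, y). x \<otimes> y)"
    and continuous_inv: "continuous_map T T (\<lambda>x. inv x)"

locale topological_cring = cring R for R (structure) +
  fixes T :: "'a topology"
  assumes topspace_eq_carrier: "topspace T = carrier R"
    and continuous_add: "continuous_map (prod_topology T T) T (\<lambda>(x, y). x \<oplus> y)"
    and continuous_neg: "continuous_map T T (\<lambda>x. \<ominus> x)"
    and continuous_mult: "continuous_map (prod_topology T T) T (\<lambda>(x, y). x \<otimes> y)"

end

theory Submission
  imports Defs
begin

text \<open>
  For the induced topology, a map with values in the units is continuous exactly when the map and
  its pointwise inverse are both continuous as maps into the ring; in particular the inclusion of the units
  and the inversion, viewed as maps into the ring, are continuous. For inversion on the units the
  two conditions are those two facts in exchanged order, since \<open>inv (inv a) = a\<close>: adding the second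
  coordinate \<open>inv a\<close> to the embedding is what forces inversion to be continuous. For multiplication
  they amount to continuity of \<open>a \<otimes> b\<close> and of \<open>inv (a \<otimes> b) = inv a \<otimes> inv b\<close>, where
  commutativity enters, and both follow from continuity of the multiplication of the ring.
\<close>

abbreviation (input) unit_topology :: "('a, 'b) monoid_scheme \<Rightarrow> 'a topology \<Rightarrow> 'a topology" where
  "unit_topology G T \<equiv>
     pullback_topology (Units G) (\<lambda>a. (a, inv\<^bsub>G\<^esub> a)) (prod_topology T T)"

lemma (in monoid) topspace_unit_topology:
  assumes "topspace T = carrier G"
  shows "topspace (unit_topology G T) = Units G"
  using assms by (auto simp: topspace_pullback_topology Units_closed)

lemma continuous_map_unit_inclusion: "continuous_map (unit_topology G T) T (\<lambda>a. a)"
  and continuous_map_unit_inv: "continuous_map (unit_topology G T) T (\<lambda>a. inv\<^bsub>G\<^esub> a)"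
  using continuous_map_pullback[OF continuous_map_fst, of "Units G" "\<lambda>a. (a, inv\<^bsub>G\<^esub> a)" T T]
    continuous_map_pullback[OF continuous_map_snd, of "Units G" "\<lambda>a. (a, inv\<^bsub>G\<^esub> a)" T T]
  by (simp_all add: o_def)

text \<open>
  This is the universal property of the induced topology. With it, continuity into the units is
  always checked in \<open>T\<close>, where the ring operations are known to be continuous.
\<close>

lemma continuous_map_into_unit_topology:
  assumes "continuous_map Y T g"
    and "continuous_map Y T (\<lambda>y. inv\<^bsub>G\<^esub> (g y))"
    and "\<And>y. y \<in> topspace Y \<Longrightarrow> g y \<in> Units G"
  shows "continuous_map Y (unit_topology G T) g"
proof (rule continuous_map_pullback')
  show "continuous_map Y (prod_topology T T) ((\<lambda>a. (a, inv\<^bsub>G\<^esub> a)) \<circ> g)"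
    using assms(1,2) by (simp add: continuous_map_pairwise o_def)
qed (use assms(3) in auto)

theorem theorem2p6:
  fixes R (structure) and T :: "'a topology"
  assumes "topological_cring R T"
  shows "topological_group (units_of R)
           (pullback_topology (Units R) (\<lambda>a. (a, inv a)) (prod_topology T T))"
proof -
  interpret topological_cring R T by fact
  let ?U = "unit_topology R T"
  have space: "topspace ?U = Units R"
    using topspace_eq_carrier by (rule topspace_unit_topology)
  have fst_cont: "continuous_map (prod_topology ?U ?U) ?U fst"
    and snd_cont: "continuous_map (prod_topology ?U ?U) ?U snd"
    by (rule continuous_map_fst continuous_map_snd)+
  have mult_cont: "continuous_map Y T (\<lambda>y. g y \<otimes> h y)"
    if "continuous_map Y T g" "continuous_map Y T h" for Y :: "('a \<times> 'a) topology" and g h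
    using continuous_map_compose[OF _ continuous_mult, of Y "\<lambda>y. (g y, h y)"] that
    by (simp add: continuous_map_pairwise o_def)
  have "continuous_map (prod_topology ?U ?U) ?U (\<lambda>p. fst p \<otimes> snd p)"
  proof (rule continuous_map_into_unit_topology)
    show "continuous_map (prod_topology ?U ?U) T (\<lambda>p. fst p \<otimes> snd p)"
      using continuous_map_compose[OF fst_cont continuous_map_unit_inclusion]
        continuous_map_compose[OF snd_cont continuous_map_unit_inclusion]
      by (simp add: mult_cont o_def)
    have "continuous_map (prod_topology ?U ?U) T (\<lambda>p. inv (fst p) \<otimes> inv (snd p))"
      using continuous_map_compose[OF fst_cont continuous_map_unit_inv]
        continuous_map_compose[OF snd_cont continuous_map_unit_inv]
      by (simp add: mult_cont o_def)
    moreover have "inv (fst p) \<otimes> inv (snd p) = inv (fst p \<otimes> snd p)"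
      if "p \<in> topspace (prod_topology ?U ?U)" for p
    proof -
      have "fst p \<in> Units R" "snd p \<in> Units R"
        using that by (auto simp: space)
      then show ?thesis
        using comm_group.inv_mult[OF units_comm_group, of "fst p" "snd p"]
        by (simp add: units_of_carrier units_of_mult units_of_inv)
    qed
    ultimately show "continuous_map (prod_topology ?U ?U) T (\<lambda>p. inv (fst p \<otimes> snd p))"
      by (rule continuous_map_eq)
  qed (auto simp: space)
  then have mult: "continuous_map (prod_topology ?U ?U) ?U (\<lambda>(x, y). x \<otimes> y)"
    by (simp add: case_prod_unfold)
  have inv: "continuous_map ?U ?U (\<lambda>x. inv x)"
  proof (rule continuous_map_into_unit_topology)
    show "continuous_map ?U T (\<lambda>x. inv (inv x))"
      by (rule continuous_map_eq[OF continuous_map_unit_inclusion]) (simp add: space)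
  qed (auto simp: space continuous_map_unit_inv)
  show ?thesis
  proof (intro topological_group.intro topological_group_axioms.intro)
    show "group (units_of R)"
      by (rule units_group)
    show "topspace ?U = carrier (units_of R)"
      by (simp add: space units_of_carrier)
    show "continuous_map (prod_topology ?U ?U) ?U (\<lambda>(x, y). x \<otimes>\<^bsub>units_of R\<^esub> y)"
      using mult by (simp add: units_of_mult)
    show "continuous_map ?U ?U (\<lambda>x. inv\<^bsub>units_of R\<^esub> x)"
      by (rule continuous_map_eq[OF inv]) (simp add: space units_of_inv)
  qed
qed

end
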